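(* Let $A,B:\mathbb S\to Set$ be functors and $\tau:A\to B$ a natural transformation. Then $\tau$ is cartesian if and only if $\hat\tau:\hat A\to\hat B$ is cartesian.
   Context: Notation: $(n]=\{1,\dots,n\}$ for $n\in\omega=\{0,1,2,\dots\}$. $\mathbb S$ is the category with objects $(n]$, $n\in\omega$, and surjections as morphisms. For a set $X$, $\left[{X\atop n}\right]$ is the set of injections $(n]\to X$, on which $S_n$ acts on the right by composition. For $A:\mathbb S\to Set$ write $A_n=A((n])$ and let $\left[{X\atop n}\right]\otimes_n A_n$ be the quotient of $\left[{X\atop n}\right]\times A_n$ by $(\vec x\circ\sigma,a)\sim(\vec x,A(\sigma)(a))$, $\sigma\in S_n$; classes are written $[\vec x,a]$. The functor $\hat A:Set\to Set$ is $\hat A(X)=\sum_{n\in\omega}\left[{X\atop n}\right]\otimes_nA_n$; for $f:X\to Y$, $\hat A(f)([\vec x,a])=[\vec y,A(\alpha)(a)]$, where $f\circ\vec x=\vec y\circ\alpha$ with $\alpha:(n]\to(m]$ surjective and $\vec y:(m]\to Y$ injective. For $\tau:A\to B$, $\hat\tau_X([\vec x,a])=[\vec x,\tau_n(a)]$. A natural transformation between $Set$-valued functors is cartesian if all its naturality squares are pullbacks. *)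

theory Defs
  imports "HOL-Library.FuncSet"
begin

section \<open>Set-valued functors and cartesian natural transformations\<close>

text \<open>
  Every element of the type of objects is an object.  Hom-sets need not be disjoint, so
  composition and functors take the objects explicitly: in \<open>Comp C x y z g f\<close> the arrows are
  \<open>f : x \<rightarrow> y\<close> and \<open>g : y \<rightarrow> z\<close>.  A map between sets is an extensional function
  (an element of \<open>X \<rightarrow>\<^sub>E Y\<close>), so equality of maps is equality of HOL functions.
\<close>

record ('o, 'm) cat =
  Hom :: "'o \<Rightarrow> 'o \<Rightarrow> 'm set"
  Id :: "'o \<Rightarrow> 'm"
  Comp :: "'o \<Rightarrow> 'o \<Rightarrow> 'o \<Rightarrow> 'm \<Rightarrow> 'm \<Rightarrow> 'm"

record ('o, 'm, 'a) set_functor =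
  Ob :: "'o \<Rightarrow> 'a set"
  Map :: "'o \<Rightarrow> 'o \<Rightarrow> 'm \<Rightarrow> 'a \<Rightarrow> 'a"

definition is_functor :: "('o, 'm) cat \<Rightarrow> ('o, 'm, 'a) set_functor \<Rightarrow> bool" where
  "is_functor C F \<longleftrightarrow>
     (\<forall>x y. \<forall>f\<in>Hom C x y. Map F x y f \<in> Ob F x \<rightarrow>\<^sub>E Ob F y) \<and>
     (\<forall>x. Map F x x (Id C x) = (\<lambda>a\<in>Ob F x. a)) \<and>
     (\<forall>x y z. \<forall>f\<in>Hom C x y. \<forall>g\<in>Hom C y z.
        Map F x z (Comp C x y z g f) = compose (Ob F x) (Map F y z g) (Map F x y f))"

definition is_nat_trans ::
  "('o, 'm) cat \<Rightarrow> ('o, 'm, 'a) set_functor \<Rightarrow> ('o, 'm, 'b) set_functor \<Rightarrow> ('o \<Rightarrow> 'a \<Rightarrow> 'b) \<Rightarrow> bool"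
where
  "is_nat_trans C F G \<tau> \<longleftrightarrow>
     (\<forall>x. \<tau> x \<in> Ob F x \<rightarrow>\<^sub>E Ob G x) \<and>
     (\<forall>x y. \<forall>f\<in>Hom C x y.
        compose (Ob F x) (\<tau> y) (Map F x y f) = compose (Ob F x) (Map G x y f) (\<tau> x))"

text \<open>
  \<open>is_pullback P A B D p q f g\<close> says that the square with \<open>p : P \<rightarrow> A\<close>, \<open>q : P \<rightarrow> B\<close>,
  \<open>f : A \<rightarrow> D\<close>, \<open>g : B \<rightarrow> D\<close> is a pullback of sets.  The sets \<open>T\<close> against which the universal
  property is tested are of the type of \<open>P\<close>, because the definition cannot quantify over types;
  lemmas \<open>is_pullback_iff_bij\<close> and \<open>is_pullback_universal\<close> show that this loses nothing.
\<close>

definition is_pullback ::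
  "'p set \<Rightarrow> 'a set \<Rightarrow> 'b set \<Rightarrow> 'd set \<Rightarrow>
   ('p \<Rightarrow> 'a) \<Rightarrow> ('p \<Rightarrow> 'b) \<Rightarrow> ('a \<Rightarrow> 'd) \<Rightarrow> ('b \<Rightarrow> 'd) \<Rightarrow> bool"
where
  "is_pullback P A B D p q f g \<longleftrightarrow>
     p \<in> P \<rightarrow>\<^sub>E A \<and> q \<in> P \<rightarrow>\<^sub>E B \<and> f \<in> A \<rightarrow>\<^sub>E D \<and> g \<in> B \<rightarrow>\<^sub>E D \<and>
     compose P f p = compose P g q \<and>
     (\<forall>T :: 'p set. \<forall>s\<in>T \<rightarrow>\<^sub>E A. \<forall>t\<in>T \<rightarrow>\<^sub>E B. compose T f s = compose T g t \<longrightarrow>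
        (\<exists>!u. u \<in> T \<rightarrow>\<^sub>E P \<and> compose T p u = s \<and> compose T q u = t))"

definition cartesian ::
  "('o, 'm) cat \<Rightarrow> ('o, 'm, 'a) set_functor \<Rightarrow> ('o, 'm, 'b) set_functor \<Rightarrow> ('o \<Rightarrow> 'a \<Rightarrow> 'b) \<Rightarrow> bool"
where
  "cartesian C F G \<tau> \<longleftrightarrow>
     (\<forall>x y. \<forall>f\<in>Hom C x y.
        is_pullback (Ob F x) (Ob F y) (Ob G x) (Ob G y) (Map F x y f) (\<tau> x) (\<tau> y) (Map G x y f))"

lemma pullback_bij_universal:
  fixes T :: "'t set"
  assumes p: "p \<in> P \<rightarrow>\<^sub>E A" and q: "q \<in> P \<rightarrow>\<^sub>E B"
    and bij: "bij_betw (\<lambda>u. (p u, q u)) P {(a, b). a \<in> A \<and> b \<in> B \<and> f a = g b}"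
    and s: "s \<in> T \<rightarrow>\<^sub>E A" and t: "t \<in> T \<rightarrow>\<^sub>E B" and st: "compose T f s = compose T g t"
  shows "\<exists>!u. u \<in> T \<rightarrow>\<^sub>E P \<and> compose T p u = s \<and> compose T q u = t"
proof -
  let ?h = "\<lambda>u. (p u, q u)"
  let ?u = "\<lambda>z\<in>T. inv_into P ?h (s z, t z)"
  have mem: "(s z, t z) \<in> ?h ` P" if "z \<in> T" for z
  proof -
    have "f (s z) = g (t z)" using fun_cong[OF st, of z] that by (simp add: compose_def)
    moreover have "s z \<in> A" "t z \<in> B" using s t that by auto
    ultimately show ?thesis using bij_betw_imp_surj_on[OF bij] by auto
  qed
  have inv: "?u z \<in> P \<and> p (?u z) = s z \<and> q (?u z) = t z" if "z \<in> T" for z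
    using inv_into_into[OF mem[OF that]] f_inv_into_f[OF mem[OF that]] that by simp
  show ?thesis
  proof (rule ex1I[of _ ?u], intro conjI)
    show "?u \<in> T \<rightarrow>\<^sub>E P" using inv by auto
    show "compose T p ?u = s"
      using inv s by (intro extensionalityI[of _ T]) (auto simp: compose_def PiE_def)
    show "compose T q ?u = t"
      using inv t by (intro extensionalityI[of _ T]) (auto simp: compose_def PiE_def)
  next
    fix v assume v: "v \<in> T \<rightarrow>\<^sub>E P \<and> compose T p v = s \<and> compose T q v = t"
    show "v = ?u"
    proof (rule extensionalityI[of _ T])
      show "v \<in> extensional T" using v by (simp add: PiE_def)
      show "?u \<in> extensional T" by simp
      fix z assume z: "z \<in> T"
      have "v z \<in> P" "p (v z) = s z" "q (v z) = t z"
        using v z by (auto simp: compose_def)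
      with inv[OF z] show "v z = ?u z"
        using bij_betw_imp_inj_on[OF bij] by (auto simp: inj_on_def)
    qed
  qed
qed

lemma is_pullback_iff_bij:
  "is_pullback P A B D p q f g \<longleftrightarrow>
     p \<in> P \<rightarrow>\<^sub>E A \<and> q \<in> P \<rightarrow>\<^sub>E B \<and> f \<in> A \<rightarrow>\<^sub>E D \<and> g \<in> B \<rightarrow>\<^sub>E D \<and>
     bij_betw (\<lambda>u. (p u, q u)) P {(a, b). a \<in> A \<and> b \<in> B \<and> f a = g b}"
  (is "?L \<longleftrightarrow> ?R")
proof
  assume L: ?L
  have maps: "p \<in> P \<rightarrow>\<^sub>E A" "q \<in> P \<rightarrow>\<^sub>E B" "f \<in> A \<rightarrow>\<^sub>E D" "g \<in> B \<rightarrow>\<^sub>E D"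
    and comm: "compose P f p = compose P g q"
    using L unfolding is_pullback_def by simp_all
  have univ: "\<exists>!u. u \<in> T \<rightarrow>\<^sub>E P \<and> compose T p u = s \<and> compose T q u = t"
    if "s \<in> T \<rightarrow>\<^sub>E A" "t \<in> T \<rightarrow>\<^sub>E B" "compose T f s = compose T g t" for T :: "'a set" and s t
    using L that unfolding is_pullback_def by simp
  have pt: "\<exists>!u. u \<in> P \<and> p u = a \<and> q u = b" if ab: "a \<in> A" "b \<in> B" "f a = g b" for a b
  proof -
    let ?T = "{undefined :: 'a}"
    have ex: "\<exists>!u. u \<in> ?T \<rightarrow>\<^sub>E P \<and> compose ?T p u = (\<lambda>z\<in>?T. a) \<and> compose ?T q u = (\<lambda>z\<in>?T. b)"
      by (rule univ) (use ab in \<open>simp_all add: compose_def cong: restrict_cong\<close>)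
    then obtain u where u: "u \<in> ?T \<rightarrow>\<^sub>E P" "compose ?T p u = (\<lambda>z\<in>?T. a)" "compose ?T q u = (\<lambda>z\<in>?T. b)"
      by blast
    show ?thesis
    proof (rule ex1I[of _ "u undefined"])
      show "u undefined \<in> P \<and> p (u undefined) = a \<and> q (u undefined) = b"
        using u(1) fun_cong[OF u(2), of undefined] fun_cong[OF u(3), of undefined]
        by (auto simp: compose_eq)
    next
      fix v assume v: "v \<in> P \<and> p v = a \<and> q v = b"
      have "(\<lambda>z\<in>?T. v) = u"
      proof -
        have "(\<lambda>z\<in>?T. v) \<in> ?T \<rightarrow>\<^sub>E P \<and> compose ?T p (\<lambda>z\<in>?T. v) = (\<lambda>z\<in>?T. a)
            \<and> compose ?T q (\<lambda>z\<in>?T. v) = (\<lambda>z\<in>?T. b)"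
          using v by (simp add: compose_def cong: restrict_cong)
        with ex u show ?thesis by blast
      qed
      then show "v = u undefined" by (metis restrict_apply singletonI)
    qed
  qed
  have "f (p u) = g (q u)" if "u \<in> P" for u
    using fun_cong[OF comm, of u] that by (simp add: compose_def)
  then have "bij_betw (\<lambda>u. (p u, q u)) P {(a, b). a \<in> A \<and> b \<in> B \<and> f a = g b}"
    unfolding bij_betw_def
  proof (intro conjI inj_onI set_eqI iffI)
    fix u v assume "\<And>u. u \<in> P \<Longrightarrow> f (p u) = g (q u)" "u \<in> P" "v \<in> P" "(p u, q u) = (p v, q v)"
    then show "u = v" using pt[of "p u" "q u"] maps by (auto dest: PiE_mem)
  next
    fix z assume "z \<in> {(a, b). a \<in> A \<and> b \<in> B \<and> f a = g b}"
    then show "z \<in> (\<lambda>u. (p u, q u)) ` P" using pt by force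
  next
    fix z assume "\<And>u. u \<in> P \<Longrightarrow> f (p u) = g (q u)" "z \<in> (\<lambda>u. (p u, q u)) ` P"
    then show "z \<in> {(a, b). a \<in> A \<and> b \<in> B \<and> f a = g b}" using maps by auto
  qed
  with maps show ?R by blast
next
  assume R: ?R
  then have "f (p u) = g (q u)" if "u \<in> P" for u
    using that by (auto simp: bij_betw_def)
  then have "compose P f p = compose P g q" by (auto simp: compose_def restrict_def)
  moreover have "\<exists>!u. u \<in> T \<rightarrow>\<^sub>E P \<and> compose T p u = s \<and> compose T q u = t"
    if "s \<in> T \<rightarrow>\<^sub>E A" "t \<in> T \<rightarrow>\<^sub>E B" "compose T f s = compose T g t" for T :: "'a set" and s t
    using R that by (intro pullback_bij_universal[of p P A q B f g]) simp_all
  ultimately show ?L using R unfolding is_pullback_def by simp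
qed

lemma is_pullback_universal:
  fixes T :: "'t set"
  assumes "is_pullback P A B D p q f g"
    and "s \<in> T \<rightarrow>\<^sub>E A" and "t \<in> T \<rightarrow>\<^sub>E B" and "compose T f s = compose T g t"
  shows "\<exists>!u. u \<in> T \<rightarrow>\<^sub>E P \<and> compose T p u = s \<and> compose T q u = t"
  using assms by (intro pullback_bij_universal[of p P A q B f g]) (auto simp: is_pullback_iff_bij)


section \<open>The categories\<close>

definition Surj_cat :: "(nat, nat \<Rightarrow> nat) cat" where
  "Surj_cat = \<lparr>
     Hom = (\<lambda>n m. {\<alpha> \<in> {1..n} \<rightarrow>\<^sub>E {1..m}. \<alpha> ` {1..n} = {1..m}}),
     Id = (\<lambda>n. \<lambda>i\<in>{1..n}. i),
     Comp = (\<lambda>n m k \<beta> \<alpha>. compose {1..n} \<beta> \<alpha>)\<rparr>"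

text \<open>The category of sets, with the subsets of the type \<open>'x\<close> as objects.\<close>

definition Set_cat :: "('x set, 'x \<Rightarrow> 'x) cat" where
  "Set_cat = \<lparr>
     Hom = (\<lambda>X Y. X \<rightarrow>\<^sub>E Y),
     Id = (\<lambda>X. \<lambda>x\<in>X. x),
     Comp = (\<lambda>X Y Z g f. compose X g f)\<rparr>"


section \<open>The functor \<open>hat A\<close>\<close>

definition injections :: "nat \<Rightarrow> 'x set \<Rightarrow> (nat \<Rightarrow> 'x) set" where
  "injections n X = {x \<in> {1..n} \<rightarrow>\<^sub>E X. inj_on x {1..n}}"

definition Sym :: "nat \<Rightarrow> (nat \<Rightarrow> nat) set" where
  "Sym n = {\<sigma> \<in> {1..n} \<rightarrow>\<^sub>E {1..n}. bij_betw \<sigma> {1..n} {1..n}}"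

text \<open>
  The pairs \<open>((x \<circ> \<sigma>, a), (x, A(\<sigma>)(a)))\<close>.  These already form an equivalence relation
  (lemma \<open>equiv_tensor_rel\<close>), so no closure is taken.
\<close>

definition tensor_rel ::
  "(nat, nat \<Rightarrow> nat, 'a) set_functor \<Rightarrow> nat \<Rightarrow> 'x set \<Rightarrow> (((nat \<Rightarrow> 'x) \<times> 'a) \<times> ((nat \<Rightarrow> 'x) \<times> 'a)) set"
where
  "tensor_rel A n X =
     {((compose {1..n} x \<sigma>, a), (x, Map A n n \<sigma> a)) | x \<sigma> a.
        x \<in> injections n X \<and> \<sigma> \<in> Sym n \<and> a \<in> Ob A n}"

definition tensor ::
  "(nat, nat \<Rightarrow> nat, 'a) set_functor \<Rightarrow> nat \<Rightarrow> 'x set \<Rightarrow> ((nat \<Rightarrow> 'x) \<times> 'a) set set"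
where
  "tensor A n X = (injections n X \<times> Ob A n) // tensor_rel A n X"

definition tensor_class ::
  "(nat, nat \<Rightarrow> nat, 'a) set_functor \<Rightarrow> nat \<Rightarrow> 'x set \<Rightarrow> (nat \<Rightarrow> 'x) \<Rightarrow> 'a \<Rightarrow> ((nat \<Rightarrow> 'x) \<times> 'a) set"
where
  "tensor_class A n X x a = tensor_rel A n X `` {(x, a)}"

definition hat_Ob ::
  "(nat, nat \<Rightarrow> nat, 'a) set_functor \<Rightarrow> 'x set \<Rightarrow> (nat \<times> ((nat \<Rightarrow> 'x) \<times> 'a) set) set"
where
  "hat_Ob A X = (SIGMA n:UNIV. tensor A n X)"

text \<open>
  The value at \<open>(n, c)\<close> is the common value of the defining formula over all representatives
  \<open>(x, a)\<close> of \<open>c\<close> and all factorisations \<open>f \<circ> x = y \<circ> \<alpha>\<close>; that it exists and is unique is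
  lemma \<open>hat_Map_class\<close>.
\<close>

definition hat_Map ::
  "(nat, nat \<Rightarrow> nat, 'a) set_functor \<Rightarrow> 'x set \<Rightarrow> 'x set \<Rightarrow> ('x \<Rightarrow> 'x) \<Rightarrow>
   nat \<times> ((nat \<Rightarrow> 'x) \<times> 'a) set \<Rightarrow> nat \<times> ((nat \<Rightarrow> 'x) \<times> 'a) set"
where
  "hat_Map A X Y f = (\<lambda>(n, c)\<in>hat_Ob A X. THE d. \<exists>x a m \<alpha> y.
     (x, a) \<in> c \<and> \<alpha> \<in> Hom Surj_cat n m \<and> y \<in> injections m Y \<and>
     compose {1..n} f x = compose {1..n} y \<alpha> \<and> d = (m, tensor_class A m Y y (Map A n m \<alpha> a)))"

definition hat ::
  "(nat, nat \<Rightarrow> nat, 'a) set_functor \<Rightarrow>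
   ('x set, 'x \<Rightarrow> 'x, nat \<times> ((nat \<Rightarrow> 'x) \<times> 'a) set) set_functor"
where
  "hat A = \<lparr>Ob = hat_Ob A, Map = hat_Map A\<rparr>"

text \<open>As for \<open>hat_Map\<close>, the description is unique by lemma \<open>hat_trans_class\<close>.\<close>

definition hat_trans ::
  "(nat, nat \<Rightarrow> nat, 'a) set_functor \<Rightarrow> (nat, nat \<Rightarrow> nat, 'b) set_functor \<Rightarrow> (nat \<Rightarrow> 'a \<Rightarrow> 'b) \<Rightarrow>
   'x set \<Rightarrow> nat \<times> ((nat \<Rightarrow> 'x) \<times> 'a) set \<Rightarrow> nat \<times> ((nat \<Rightarrow> 'x) \<times> 'b) set"
where
  "hat_trans A B \<tau> X = (\<lambda>(n, c)\<in>hat_Ob A X. THE d. \<exists>x a.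
     (x, a) \<in> c \<and> d = (n, tensor_class B n X x (\<tau> n a)))"

subsection \<open>Well-definedness\<close>

lemma Hom_Surj: "\<alpha> \<in> Hom Surj_cat n m \<longleftrightarrow> \<alpha> \<in> {1..n} \<rightarrow>\<^sub>E {1..m} \<and> \<alpha> ` {1..n} = {1..m}"
  by (simp add: Surj_cat_def)

lemma Comp_Surj: "Comp Surj_cat n m k \<beta> \<alpha> = compose {1..n} \<beta> \<alpha>"
  by (simp add: Surj_cat_def)

lemma Id_Surj: "Id Surj_cat n = (\<lambda>i\<in>{1..n}. i)"
  by (simp add: Surj_cat_def)

lemma Hom_Set: "f \<in> Hom Set_cat X Y \<longleftrightarrow> f \<in> X \<rightarrow>\<^sub>E Y"
  by (simp add: Set_cat_def)

lemma Comp_Surj_Hom: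
  assumes "\<alpha> \<in> Hom Surj_cat n m" and "\<beta> \<in> Hom Surj_cat m k"
  shows "compose {1..n} \<beta> \<alpha> \<in> Hom Surj_cat n k"
proof -
  have "compose {1..n} \<beta> \<alpha> ` {1..n} = \<beta> ` (\<alpha> ` {1..n})"
    by (auto simp: compose_def image_image)
  with assms show ?thesis by (auto simp: Hom_Surj compose_def)
qed

lemma Sym_Hom: "\<sigma> \<in> Sym n \<Longrightarrow> \<sigma> \<in> Hom Surj_cat n n"
  by (auto simp: Sym_def Hom_Surj bij_betw_def)

lemma functor_mem:
  assumes "is_functor C F" and "f \<in> Hom C x y" and "a \<in> Ob F x"
  shows "Map F x y f a \<in> Ob F y"
proof -
  have "Map F x y f \<in> Ob F x \<rightarrow>\<^sub>E Ob F y" using assms by (auto simp: is_functor_def)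
  then show ?thesis using assms(3) by auto
qed

lemma functor_comp:
  assumes "is_functor C F" and "f \<in> Hom C x y" and "g \<in> Hom C y z" and "a \<in> Ob F x"
  shows "Map F x z (Comp C x y z g f) a = Map F y z g (Map F x y f a)"
proof -
  have "Map F x z (Comp C x y z g f) = compose (Ob F x) (Map F y z g) (Map F x y f)"
    using assms by (auto simp: is_functor_def)
  then show ?thesis using assms(4) by (simp add: compose_def)
qed

lemma functor_id: "is_functor C F \<Longrightarrow> a \<in> Ob F x \<Longrightarrow> Map F x x (Id C x) a = a"
  by (simp add: is_functor_def)

lemma nat_trans_mem: "is_nat_trans C F G \<tau> \<Longrightarrow> a \<in> Ob F x \<Longrightarrow> \<tau> x a \<in> Ob G x"
  by (auto simp: is_nat_trans_def dest: PiE_mem)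

lemma nat_trans_naturality:
  assumes "is_nat_trans C F G \<tau>" and "f \<in> Hom C x y" and "a \<in> Ob F x"
  shows "\<tau> y (Map F x y f a) = Map G x y f (\<tau> x a)"
proof -
  have "compose (Ob F x) (\<tau> y) (Map F x y f) = compose (Ob F x) (Map G x y f) (\<tau> x)"
    using assms by (auto simp: is_nat_trans_def)
  from fun_cong[OF this, of a] show ?thesis using assms(3) by (simp add: compose_def)
qed

lemma Surj_comp:
  assumes "is_functor Surj_cat A" and "\<alpha> \<in> Hom Surj_cat n m" and "\<beta> \<in> Hom Surj_cat m k" and "a \<in> Ob A n"
  shows "Map A n k (compose {1..n} \<beta> \<alpha>) a = Map A m k \<beta> (Map A n m \<alpha> a)"
  using functor_comp[OF assms] by (simp add: Comp_Surj)

lemma injections_Sym: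
  assumes "x \<in> injections n X" and "\<sigma> \<in> Sym n"
  shows "compose {1..n} x \<sigma> \<in> injections n X"
proof -
  have "inj_on \<sigma> {1..n}" "\<sigma> ` {1..n} = {1..n}"
    using assms(2) by (simp_all add: Sym_def bij_betw_def)
  moreover have x: "inj_on x {1..n}" "x \<in> {1..n} \<rightarrow>\<^sub>E X"
    using assms(1) by (simp_all add: injections_def)
  ultimately have "inj_on (x \<circ> \<sigma>) {1..n}" by (simp add: comp_inj_on)
  then have "inj_on (compose {1..n} x \<sigma>) {1..n}"
    by (subst inj_on_cong[of _ _ "x \<circ> \<sigma>"]) (simp_all add: compose_def)
  moreover have "\<sigma> i \<in> {1..n}" if "i \<in> {1..n}" for i
    using \<open>\<sigma> ` {1..n} = {1..n}\<close> that by blast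
  then have "compose {1..n} x \<sigma> \<in> {1..n} \<rightarrow>\<^sub>E X"
    using PiE_mem[OF x(2)] by (intro PiE_I) (simp_all only: compose_def restrict_apply if_True if_False)
  ultimately show ?thesis by (simp add: injections_def)
qed

text \<open>Two injections with the same image differ by a unique permutation.\<close>

lemma injections_same_image:
  assumes y: "y \<in> injections m Y" and z: "z \<in> injections k Y"
    and im: "y ` {1..m} = z ` {1..k}"
  shows "m = k" and "\<exists>\<rho>\<in>Sym m. y = compose {1..m} z \<rho>"
proof -
  have inj: "inj_on y {1..m}" "inj_on z {1..k}" using y z by (auto simp: injections_def)
  show mk: "m = k"
    using card_image[OF inj(1)] card_image[OF inj(2)] im by simp
  let ?r = "\<lambda>i\<in>{1..m}. inv_into {1..m} z (y i)"
  have zi: "bij_betw (inv_into {1..m} z) (z ` {1..m}) {1..m}"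
    using inj(2) mk by (simp add: inj_on_imp_bij_betw bij_betw_inv_into)
  have yi: "bij_betw y {1..m} (z ` {1..m})"
    using inj(1) im mk by (simp add: bij_betw_def)
  have "bij_betw ?r {1..m} {1..m}"
    using bij_betw_trans[OF yi zi] by (subst bij_betw_cong[of _ _ "inv_into {1..m} z \<circ> y"]) auto
  then have "?r \<in> Sym m" by (auto simp: Sym_def bij_betw_def)
  moreover have "y = compose {1..m} z ?r"
  proof (rule extensionalityI[of _ "{1..m}"])
    show "y \<in> extensional {1..m}" using y by (simp add: injections_def PiE_def)
    fix i assume i: "i \<in> {1..m}"
    then have "y i \<in> z ` {1..m}" using im mk by auto
    then show "y i = compose {1..m} z ?r i" using i by (simp add: compose_def f_inv_into_f)
  qed (simp add: compose_def)
  ultimately show "\<exists>\<rho>\<in>Sym m. y = compose {1..m} z \<rho>" by blast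
qed

lemma injections_cancel:
  assumes "y \<in> injections m Y" and "\<alpha> \<in> {1..n} \<rightarrow>\<^sub>E {1..m}" and "\<beta> \<in> {1..n} \<rightarrow>\<^sub>E {1..m}"
    and "compose {1..n} y \<alpha> = compose {1..n} y \<beta>"
  shows "\<alpha> = \<beta>"
proof (rule extensionalityI[of _ "{1..n}"])
  fix i assume i: "i \<in> {1..n}"
  then have "y (\<alpha> i) = y (\<beta> i)" using fun_cong[OF assms(4), of i] by (simp add: compose_def)
  moreover have "\<alpha> i \<in> {1..m}" "\<beta> i \<in> {1..m}" using assms(2,3) i by (blast dest: PiE_mem)+
  ultimately show "\<alpha> i = \<beta> i"
    using assms(1) unfolding injections_def by (blast dest: inj_onD)
qed (use assms in \<open>simp_all add: PiE_def\<close>)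

lemma factorisation_exists:
  assumes "g \<in> {1..n} \<rightarrow>\<^sub>E Y"
  obtains m \<alpha> y where "\<alpha> \<in> Hom Surj_cat n m" "y \<in> injections m Y" "g = compose {1..n} y \<alpha>"
proof -
  let ?I = "g ` {1..n}"
  obtain h where h: "bij_betw h {1..card ?I} ?I"
    using ex_bij_betw_nat_finite_1[of ?I] by auto
  let ?m = "card ?I"
  let ?y = "\<lambda>i\<in>{1..?m}. h i"
  let ?a = "\<lambda>i\<in>{1..n}. inv_into {1..?m} h (g i)"
  have hi: "bij_betw (inv_into {1..?m} h) ?I {1..?m}" using h by (rule bij_betw_inv_into)
  have "?a ` {1..n} = inv_into {1..?m} h ` ?I" by (auto simp: image_image)
  also have "\<dots> = {1..?m}" using hi by (rule bij_betw_imp_surj_on)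
  finally have "?a \<in> Hom Surj_cat n ?m" by (auto simp: Hom_Surj)
  moreover have "?y \<in> injections ?m Y"
  proof -
    have "h ` {1..?m} \<subseteq> Y" using h assms by (auto simp: bij_betw_def)
    moreover have "inj_on ?y {1..?m}"
      using h by (subst inj_on_cong[of _ _ h]) (simp_all add: bij_betw_def)
    ultimately show ?thesis by (auto simp: injections_def)
  qed
  moreover have "g = compose {1..n} ?y ?a"
  proof (rule extensionalityI[of _ "{1..n}"])
    show "g \<in> extensional {1..n}" using assms by (simp add: PiE_def)
    fix i assume i: "i \<in> {1..n}"
    then have gi: "g i \<in> h ` {1..?m}" using h by (auto simp: bij_betw_def)
    then have "inv_into {1..?m} h (g i) \<in> {1..?m}" by (rule inv_into_into)
    then show "g i = compose {1..n} ?y ?a i"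
      using i f_inv_into_f[OF gi] by (simp add: compose_def)
  qed (simp add: compose_def)
  ultimately show ?thesis using that by blast
qed

lemma tensor_relI:
  assumes "x \<in> injections n X" and "\<sigma> \<in> Sym n" and "a \<in> Ob A n"
  shows "((compose {1..n} x \<sigma>, a), (x, Map A n n \<sigma> a)) \<in> tensor_rel A n X"
  using assms unfolding tensor_rel_def by blast

lemma equiv_tensor_rel:
  assumes A: "is_functor Surj_cat A"
  shows "equiv (injections n X \<times> Ob A n) (tensor_rel A n X)"
proof (rule equivI)
  show "tensor_rel A n X \<subseteq> (injections n X \<times> Ob A n) \<times> (injections n X \<times> Ob A n)"
    unfolding tensor_rel_def by (clarsimp simp: injections_Sym[simplified] functor_mem[OF A] Sym_Hom)
  show "refl_on (injections n X \<times> Ob A n) (tensor_rel A n X)"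
  proof (rule refl_onI)
    fix z assume "z \<in> injections n X \<times> Ob A n"
    then obtain x a where z: "z = (x, a)" "x \<in> injections n X" "a \<in> Ob A n" by auto
    have "(\<lambda>i\<in>{1..n}. i) \<in> Sym n" by (auto simp: Sym_def bij_betw_def inj_on_def)
    moreover have "compose {1..n} x (\<lambda>i\<in>{1..n}. i) = x"
      using z(2) by (intro extensionalityI[of _ "{1..n}"]) (auto simp: injections_def compose_def PiE_def)
    moreover have "Map A n n (\<lambda>i\<in>{1..n}. i) a = a"
      using functor_id[OF A z(3)] by (simp add: Id_Surj)
    ultimately show "(z, z) \<in> tensor_rel A n X" using tensor_relI[of x n X "\<lambda>i\<in>{1..n}. i" a A] z by simp
  qed
  show "sym (tensor_rel A n X)"
  proof (rule symI)
    fix u v assume "(u, v) \<in> tensor_rel A n X"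
    then obtain x \<sigma> a where u: "u = (compose {1..n} x \<sigma>, a)" and v: "v = (x, Map A n n \<sigma> a)"
      and mem: "x \<in> injections n X" "\<sigma> \<in> Sym n" "a \<in> Ob A n"
      unfolding tensor_rel_def by blast
    have x': "compose {1..n} x \<sigma> \<in> injections n X" using mem injections_Sym by blast
    have "\<sigma> ` {1..n} = {1..n}" using mem(2) by (auto simp: Sym_def bij_betw_def)
    then have "x ` {1..n} = compose {1..n} x \<sigma> ` {1..n}"
      by (metis (no_types, lifting) compose_eq image_cong image_image)
    then obtain \<rho> where \<rho>: "\<rho> \<in> Sym n" "x = compose {1..n} (compose {1..n} x \<sigma>) \<rho>"
      using injections_same_image[OF mem(1) x'] by blast
    have "compose {1..n} \<rho> \<sigma> = (\<lambda>i\<in>{1..n}. i)"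
    proof (rule injections_cancel[OF x'])
      have r: "\<rho> (\<sigma> i) \<in> {1..n}" "\<sigma> i \<in> {1..n}" if "i \<in> {1..n}" for i
        using mem(2) \<rho>(1) that unfolding Sym_def by (blast dest: PiE_mem)+
      then show "compose {1..n} \<rho> \<sigma> \<in> {1..n} \<rightarrow>\<^sub>E {1..n}" by (auto simp: compose_def)
      show "(\<lambda>i\<in>{1..n}. i) \<in> {1..n} \<rightarrow>\<^sub>E {1..n}" by auto
      show "compose {1..n} (compose {1..n} x \<sigma>) (compose {1..n} \<rho> \<sigma>) =
          compose {1..n} (compose {1..n} x \<sigma>) (\<lambda>i\<in>{1..n}. i)"
      proof (rule extensionalityI[of _ "{1..n}"])
        fix i assume i: "i \<in> {1..n}"
        have "x (\<sigma> i) = x (\<sigma> (\<rho> (\<sigma> i)))"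
          using fun_cong[OF \<rho>(2), of "\<sigma> i"] r[OF i] by (simp add: compose_def)
        then show "compose {1..n} (compose {1..n} x \<sigma>) (compose {1..n} \<rho> \<sigma>) i =
            compose {1..n} (compose {1..n} x \<sigma>) (\<lambda>i\<in>{1..n}. i) i"
          using i r[OF i] by (simp add: compose_def)
      qed (simp_all add: compose_def)
    qed
    then have "Map A n n \<rho> (Map A n n \<sigma> a) = a"
      using Surj_comp[OF A Sym_Hom[OF mem(2)] Sym_Hom[OF \<rho>(1)] mem(3)] functor_id[OF A mem(3)]
      by (simp add: Id_Surj)
    then show "(v, u) \<in> tensor_rel A n X"
      using tensor_relI[OF x' \<rho>(1) functor_mem[OF A Sym_Hom[OF mem(2)] mem(3)]]
      unfolding u v \<rho>(2)[symmetric] by simp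
  qed
  show "trans (tensor_rel A n X)"
  proof (rule transI)
    fix u v w assume uv: "(u, v) \<in> tensor_rel A n X" and vw: "(v, w) \<in> tensor_rel A n X"
    from vw obtain y \<rho> b where v: "v = (compose {1..n} y \<rho>, b)" and w: "w = (y, Map A n n \<rho> b)"
      and m2: "y \<in> injections n X" "\<rho> \<in> Sym n" "b \<in> Ob A n"
      unfolding tensor_rel_def by blast
    from uv v obtain \<sigma> a where u: "u = (compose {1..n} (compose {1..n} y \<rho>) \<sigma>, a)"
      and m1: "b = Map A n n \<sigma> a" "\<sigma> \<in> Sym n" "a \<in> Ob A n"
      unfolding tensor_rel_def by blast
    have \<sigma>n: "\<sigma> i \<in> {1..n}" if "i \<in> {1..n}" for i
      using m1(2) that unfolding Sym_def by (blast dest: PiE_mem)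
    have "bij_betw (compose {1..n} \<rho> \<sigma>) {1..n} {1..n}"
      using m1(2) m2(2) unfolding Sym_def by (blast intro: bij_betw_compose)
    then have "compose {1..n} \<rho> \<sigma> \<in> Sym n"
      unfolding Sym_def by (auto simp: compose_def bij_betw_def)
    moreover have "compose {1..n} (compose {1..n} y \<rho>) \<sigma> = compose {1..n} y (compose {1..n} \<rho> \<sigma>)"
      using \<sigma>n by (simp add: compose_def cong: restrict_cong)
    moreover have "Map A n n (compose {1..n} \<rho> \<sigma>) a = Map A n n \<rho> b"
      using Surj_comp[OF A Sym_Hom[OF m1(2)] Sym_Hom[OF m2(2)] m1(3)] m1(1) by simp
    ultimately show "(u, w) \<in> tensor_rel A n X"
      using tensor_relI[of y n X "compose {1..n} \<rho> \<sigma>" a A] m2(1) m1(3) u w by simp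
  qed
qed

lemma tensor_class_eqI:
  assumes "is_functor Surj_cat A" and "((x, a), (y, b)) \<in> tensor_rel A n X"
  shows "tensor_class A n X x a = tensor_class A n X y b"
  unfolding tensor_class_def using equiv_class_eq[OF equiv_tensor_rel[OF assms(1)] assms(2)] .

lemma tensor_class_self:
  assumes "is_functor Surj_cat A" and "x \<in> injections n X" and "a \<in> Ob A n"
  shows "(x, a) \<in> tensor_class A n X x a"
  unfolding tensor_class_def using equiv_class_self[OF equiv_tensor_rel[OF assms(1)]] assms by auto

lemma tensor_class_hat_Ob:
  "x \<in> injections n X \<Longrightarrow> a \<in> Ob A n \<Longrightarrow> (n, tensor_class A n X x a) \<in> hat_Ob A X"
  unfolding hat_Ob_def tensor_def tensor_class_def by (auto intro: quotientI)

lemma hat_Ob_cases: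
  assumes "z \<in> hat_Ob A X"
  obtains n x a where "z = (n, tensor_class A n X x a)" "x \<in> injections n X" "a \<in> Ob A n"
  using assms unfolding hat_Ob_def tensor_def tensor_class_def by (auto elim!: quotientE)

lemma hat_Map_class:
  assumes A: "is_functor Surj_cat A" and f: "f \<in> X \<rightarrow>\<^sub>E Y"
    and x: "x \<in> injections n X" and a: "a \<in> Ob A n"
    and \<alpha>: "\<alpha> \<in> Hom Surj_cat n m" and y: "y \<in> injections m Y"
    and fx: "compose {1..n} f x = compose {1..n} y \<alpha>"
  shows "hat_Map A X Y f (n, tensor_class A n X x a) = (m, tensor_class A m Y y (Map A n m \<alpha> a))"
proof -
  let ?c = "tensor_class A n X x a"
  have uniq: "d = (m, tensor_class A m Y y (Map A n m \<alpha> a))"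
    if "(x', a') \<in> ?c" and \<alpha>': "\<alpha>' \<in> Hom Surj_cat n k" and y': "y' \<in> injections k Y"
      and fx': "compose {1..n} f x' = compose {1..n} y' \<alpha>'"
      and d: "d = (k, tensor_class A k Y y' (Map A n k \<alpha>' a'))" for d x' a' k \<alpha>' y'
  proof -
    from that(1) have "((x, a), (x', a')) \<in> tensor_rel A n X" by (simp add: tensor_class_def)
    then obtain \<sigma> where \<sigma>: "\<sigma> \<in> Sym n" and xx: "x = compose {1..n} x' \<sigma>" and aa: "a' = Map A n n \<sigma> a"
      unfolding tensor_rel_def by blast
    define \<beta> where "\<beta> = compose {1..n} \<alpha>' \<sigma>"
    have \<beta>: "\<beta> \<in> Hom Surj_cat n k" unfolding \<beta>_def using Comp_Surj_Hom[OF Sym_Hom[OF \<sigma>] \<alpha>'] .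
    have \<sigma>n: "\<sigma> i \<in> {1..n}" if "i \<in> {1..n}" for i using \<sigma> that by (auto simp: Sym_def dest: PiE_mem)
    have pt: "y (\<alpha> i) = y' (\<beta> i)" if i: "i \<in> {1..n}" for i
    proof -
      have "y (\<alpha> i) = f (x' (\<sigma> i))" using fun_cong[OF fx, of i] i xx by (simp add: compose_def)
      also have "\<dots> = y' (\<alpha>' (\<sigma> i))" using fun_cong[OF fx', of "\<sigma> i"] \<sigma>n[OF i] by (simp add: compose_def)
      finally show ?thesis using i by (simp add: \<beta>_def compose_def)
    qed
    have "y ` {1..m} = y ` \<alpha> ` {1..n}" using \<alpha> by (simp add: Hom_Surj)
    also have "\<dots> = y' ` \<beta> ` {1..n}" using pt by (simp add: image_image)
    also have "\<dots> = y' ` {1..k}" using \<beta> by (simp add: Hom_Surj)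
    finally have im: "y ` {1..m} = y' ` {1..k}" .
    have mk: "m = k" using injections_same_image(1)[OF y y' im] .
    obtain \<rho> where \<rho>: "\<rho> \<in> Sym m" and yy: "y = compose {1..m} y' \<rho>"
      using injections_same_image(2)[OF y y' im] by blast
    have \<rho>\<alpha>: "compose {1..n} \<rho> \<alpha> = \<beta>"
    proof (rule injections_cancel[OF y'])
      show "compose {1..n} \<rho> \<alpha> \<in> {1..n} \<rightarrow>\<^sub>E {1..k}"
        using Comp_Surj_Hom[OF \<alpha> Sym_Hom[OF \<rho>]] mk by (simp add: Hom_Surj)
      show "\<beta> \<in> {1..n} \<rightarrow>\<^sub>E {1..k}" using \<beta> by (simp add: Hom_Surj)
      show "compose {1..n} y' (compose {1..n} \<rho> \<alpha>) = compose {1..n} y' \<beta>"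
      proof (rule extensionalityI[of _ "{1..n}"])
        fix i assume i: "i \<in> {1..n}"
        have "\<alpha> i \<in> {1..m}" using \<alpha> i unfolding Hom_Surj by (blast dest: PiE_mem)
        then have "y (\<alpha> i) = y' (\<rho> (\<alpha> i))" by (subst yy) (simp add: compose_def)
        then show "compose {1..n} y' (compose {1..n} \<rho> \<alpha>) i = compose {1..n} y' \<beta> i"
          using pt[OF i] i by (simp add: compose_def)
      qed (simp_all add: compose_def)
    qed
    have \<alpha>a: "Map A n m \<alpha> a \<in> Ob A m" using functor_mem[OF A \<alpha> a] .
    have "Map A n k \<alpha>' a' = Map A n m \<beta> a"
      unfolding aa \<beta>_def using Surj_comp[OF A Sym_Hom[OF \<sigma>] \<alpha>' a] mk by simp
    also have "\<dots> = Map A m m \<rho> (Map A n m \<alpha> a)"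
      unfolding \<rho>\<alpha>[symmetric] using Surj_comp[OF A \<alpha> Sym_Hom[OF \<rho>] a] by simp
    finally have "((y, Map A n m \<alpha> a), (y', Map A n k \<alpha>' a')) \<in> tensor_rel A m Y"
      using tensor_relI[of y' m Y \<rho> "Map A n m \<alpha> a" A] y' mk \<rho> \<alpha>a yy by simp
    from tensor_class_eqI[OF A this] show ?thesis using d mk by simp
  qed
  show ?thesis
    unfolding hat_Map_def using tensor_class_hat_Ob[OF x a]
    apply (subst restrict_apply', assumption)
    apply (simp only: prod.case)
    apply (rule the_equality)
    subgoal using tensor_class_self[OF A x a] \<alpha> y fx by blast
    subgoal using uniq by blast
    done
qed

lemma hat_trans_class:
  assumes A: "is_functor Surj_cat A" and B: "is_functor Surj_cat B" and \<tau>: "is_nat_trans Surj_cat A B \<tau>"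
    and x: "x \<in> injections n X" and a: "a \<in> Ob A n"
  shows "hat_trans A B \<tau> X (n, tensor_class A n X x a) = (n, tensor_class B n X x (\<tau> n a))"
proof -
  have uniq: "tensor_class B n X x' (\<tau> n a') = tensor_class B n X x (\<tau> n a)"
    if "(x', a') \<in> tensor_class A n X x a" for x' a'
  proof -
    from that have "((x, a), (x', a')) \<in> tensor_rel A n X" by (simp add: tensor_class_def)
    then obtain \<sigma> where \<sigma>: "x' \<in> injections n X" "\<sigma> \<in> Sym n" "x = compose {1..n} x' \<sigma>" "a' = Map A n n \<sigma> a"
      unfolding tensor_rel_def by blast
    have "((x, \<tau> n a), (x', \<tau> n a')) \<in> tensor_rel B n X"
      using tensor_relI[OF \<sigma>(1,2) nat_trans_mem[OF \<tau> a]] \<sigma>(3,4)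
        nat_trans_naturality[OF \<tau> Sym_Hom[OF \<sigma>(2)] a] by simp
    from tensor_class_eqI[OF B this] show ?thesis by simp
  qed
  show ?thesis
    unfolding hat_trans_def using tensor_class_hat_Ob[OF x a]
    apply (subst restrict_apply', assumption)
    apply (simp only: prod.case)
    apply (rule the_equality)
    subgoal using tensor_class_self[OF A x a] by blast
    subgoal using uniq by blast
    done
qed

lemma injections_map:
  assumes "f \<in> X \<rightarrow>\<^sub>E Y" and "x \<in> injections n X"
  obtains m \<alpha> y where "\<alpha> \<in> Hom Surj_cat n m" "y \<in> injections m Y"
    "compose {1..n} f x = compose {1..n} y \<alpha>"
proof -
  have "compose {1..n} f x \<in> {1..n} \<rightarrow>\<^sub>E Y"
    using assms by (auto simp: injections_def compose_def dest!: PiE_mem)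
  from factorisation_exists[OF this] that show ?thesis by metis
qed

lemma hat_Map_mem:
  assumes A: "is_functor Surj_cat A" and f: "f \<in> X \<rightarrow>\<^sub>E Y"
  shows "hat_Map A X Y f \<in> hat_Ob A X \<rightarrow>\<^sub>E hat_Ob A Y"
proof (rule PiE_I)
  fix z assume "z \<in> hat_Ob A X"
  then obtain n x a where z: "z = (n, tensor_class A n X x a)" "x \<in> injections n X" "a \<in> Ob A n"
    by (rule hat_Ob_cases)
  obtain m \<alpha> y where h: "\<alpha> \<in> Hom Surj_cat n m" "y \<in> injections m Y"
    "compose {1..n} f x = compose {1..n} y \<alpha>" using injections_map[OF f z(2)] .
  show "hat_Map A X Y f z \<in> hat_Ob A Y"
    unfolding z(1) hat_Map_class[OF A f z(2,3) h]
    by (rule tensor_class_hat_Ob[OF h(2) functor_mem[OF A h(1) z(3)]])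
qed (simp add: hat_Map_def)

lemma hat_simps: "Ob (hat A) = hat_Ob A" "Map (hat A) = hat_Map A"
  by (simp_all add: hat_def)

lemma hat_functor:
  assumes A: "is_functor Surj_cat A"
  shows "is_functor Set_cat (hat A)"
  unfolding is_functor_def hat_simps
proof (intro conjI allI ballI)
  fix X Y :: "'x set" and f assume "f \<in> Hom Set_cat X Y"
  then show "hat_Map A X Y f \<in> hat_Ob A X \<rightarrow>\<^sub>E hat_Ob A Y" using hat_Map_mem[OF A] by (simp add: Hom_Set)
next
  fix X :: "'x set"
  have I: "Id Set_cat X \<in> X \<rightarrow>\<^sub>E X" by (simp add: Set_cat_def)
  show "hat_Map A X X (Id Set_cat X) = (\<lambda>a\<in>hat_Ob A X. a)"
  proof (rule extensionalityI[of _ "hat_Ob A X"])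
    fix z assume zX: "z \<in> hat_Ob A X"
    then obtain n x a where z: "z = (n, tensor_class A n X x a)" "x \<in> injections n X" "a \<in> Ob A n"
      by (rule hat_Ob_cases)
    have eq: "compose {1..n} (Id Set_cat X) x = compose {1..n} x (Id Surj_cat n)"
    proof (rule extensionalityI[of _ "{1..n}"])
      fix i assume i: "i \<in> {1..n}"
      have "x i \<in> X" using z(2) i unfolding injections_def by (blast dest: PiE_mem)
      then show "compose {1..n} (Id Set_cat X) x i = compose {1..n} x (Id Surj_cat n) i"
        using i by (simp add: Set_cat_def Surj_cat_def compose_def)
    qed (simp_all add: compose_def)
    have "Id Surj_cat n \<in> Hom Surj_cat n n" by (auto simp: Hom_Surj Id_Surj)
    from hat_Map_class[OF A I z(2,3) this z(2) eq]
    show "hat_Map A X X (Id Set_cat X) z = (\<lambda>a\<in>hat_Ob A X. a) z"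
      using zX by (simp add: z(1) functor_id[OF A z(3)])
  qed (simp_all add: hat_Map_def)
next
  fix X Y Z :: "'x set" and f g assume "f \<in> Hom Set_cat X Y" "g \<in> Hom Set_cat Y Z"
  then have f: "f \<in> X \<rightarrow>\<^sub>E Y" and g: "g \<in> Y \<rightarrow>\<^sub>E Z" by (simp_all add: Hom_Set)
  have gf: "compose X g f \<in> X \<rightarrow>\<^sub>E Z" using f g by (intro PiE_I) (auto simp: compose_def)
  show "hat_Map A X Z (Comp Set_cat X Y Z g f) = compose (hat_Ob A X) (hat_Map A Y Z g) (hat_Map A X Y f)"
  proof (rule extensionalityI[of _ "hat_Ob A X"])
    fix z assume zX: "z \<in> hat_Ob A X"
    then obtain n x a where z: "z = (n, tensor_class A n X x a)" "x \<in> injections n X" "a \<in> Ob A n"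
      by (rule hat_Ob_cases)
    obtain m \<alpha> y where h: "\<alpha> \<in> Hom Surj_cat n m" "y \<in> injections m Y"
      "compose {1..n} f x = compose {1..n} y \<alpha>" using injections_map[OF f z(2)] .
    obtain k \<beta> w where h2: "\<beta> \<in> Hom Surj_cat m k" "w \<in> injections k Z"
      "compose {1..m} g y = compose {1..m} w \<beta>" using injections_map[OF g h(2)] .
    have "compose {1..n} (compose X g f) x = compose {1..n} w (compose {1..n} \<beta> \<alpha>)"
    proof (rule extensionalityI[of _ "{1..n}"])
      fix i assume i: "i \<in> {1..n}"
      have xi: "x i \<in> X" using z(2) i unfolding injections_def by (blast dest: PiE_mem)
      have ai: "\<alpha> i \<in> {1..m}" using h(1) i unfolding Hom_Surj by (blast dest: PiE_mem)
      have "f (x i) = y (\<alpha> i)" using fun_cong[OF h(3), of i] i by (simp add: compose_def)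
      moreover have "g (y (\<alpha> i)) = w (\<beta> (\<alpha> i))" using fun_cong[OF h2(3), of "\<alpha> i"] ai by (simp add: compose_def)
      ultimately show "compose {1..n} (compose X g f) x i = compose {1..n} w (compose {1..n} \<beta> \<alpha>) i"
        using i xi by (simp add: compose_def)
    qed (simp_all add: compose_def)
    from hat_Map_class[OF A gf z(2,3) Comp_Surj_Hom[OF h(1) h2(1)] h2(2) this]
    show "hat_Map A X Z (Comp Set_cat X Y Z g f) z = compose (hat_Ob A X) (hat_Map A Y Z g) (hat_Map A X Y f) z"
      using zX hat_Map_class[OF A f z(2,3) h] hat_Map_class[OF A g h(2) functor_mem[OF A h(1) z(3)] h2]
        Surj_comp[OF A h(1) h2(1) z(3)]
      by (simp add: compose_eq z(1) Set_cat_def)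
  qed (simp_all add: hat_Map_def compose_def)
qed

lemma hat_nat_trans:
  assumes A: "is_functor Surj_cat A" and B: "is_functor Surj_cat B" and \<tau>: "is_nat_trans Surj_cat A B \<tau>"
  shows "is_nat_trans Set_cat (hat A) (hat B) (hat_trans A B \<tau>)"
  unfolding is_nat_trans_def hat_simps
proof (intro conjI allI ballI)
  fix X :: "'x set"
  show "hat_trans A B \<tau> X \<in> hat_Ob A X \<rightarrow>\<^sub>E hat_Ob B X"
  proof (rule PiE_I)
    fix z assume "z \<in> hat_Ob A X"
    then obtain n x a where z: "z = (n, tensor_class A n X x a)" "x \<in> injections n X" "a \<in> Ob A n"
      by (rule hat_Ob_cases)
    show "hat_trans A B \<tau> X z \<in> hat_Ob B X"
      unfolding z(1) hat_trans_class[OF A B \<tau> z(2,3)]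
      by (rule tensor_class_hat_Ob[OF z(2) nat_trans_mem[OF \<tau> z(3)]])
  qed (simp add: hat_trans_def)
next
  fix X Y :: "'x set" and f assume "f \<in> Hom Set_cat X Y"
  then have f: "f \<in> X \<rightarrow>\<^sub>E Y" by (simp add: Hom_Set)
  show "compose (hat_Ob A X) (hat_trans A B \<tau> Y) (hat_Map A X Y f) =
      compose (hat_Ob A X) (hat_Map B X Y f) (hat_trans A B \<tau> X)"
  proof (rule extensionalityI[of _ "hat_Ob A X"])
    fix z assume zX: "z \<in> hat_Ob A X"
    then obtain n x a where z: "z = (n, tensor_class A n X x a)" "x \<in> injections n X" "a \<in> Ob A n"
      by (rule hat_Ob_cases)
    obtain m \<alpha> y where h: "\<alpha> \<in> Hom Surj_cat n m" "y \<in> injections m Y"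
      "compose {1..n} f x = compose {1..n} y \<alpha>" using injections_map[OF f z(2)] .
    show "compose (hat_Ob A X) (hat_trans A B \<tau> Y) (hat_Map A X Y f) z =
      compose (hat_Ob A X) (hat_Map B X Y f) (hat_trans A B \<tau> X) z"
      using zX hat_Map_class[OF A f z(2,3) h] hat_trans_class[OF A B \<tau> z(2,3)]
        hat_trans_class[OF A B \<tau> h(2) functor_mem[OF A h(1) z(3)]]
        hat_Map_class[OF B f z(2) nat_trans_mem[OF \<tau> z(3)] h]
        nat_trans_naturality[OF \<tau> h(1) z(3)]
      by (simp add: compose_eq z(1))
  qed (simp_all add: compose_def)
qed

end

theory Submission
  imports Defs
begin

text \<open>
  An injection \<open>x\<close> has trivial stabiliser under permutations, so \<open>a\<close> can be recovered from
  \<open>[x, a]\<close> once \<open>x\<close> is fixed; and an element of \<open>hat A X\<close> lying over \<open>[x, b]\<close> has a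
  representative with the same \<open>x\<close>.  Hence the fibre of \<open>hat \<tau>\<close> over \<open>[x, b]\<close> is the fibre of
  \<open>\<tau>\<close> over \<open>b\<close>, and when \<open>f \<circ> x = y \<circ> \<alpha>\<close> the action of \<open>f\<close> on fibres is that of \<open>\<alpha>\<close>.  A square
  is a pullback iff it is bijective on fibres.  For the converse, every surjection \<open>\<alpha>\<close> is
  realised by such an \<open>f\<close>, because the finite sets \<open>{1..n}\<close> embed in the infinite type \<open>'x\<close>.
\<close>

lemma bij_betw_iff_ex1:
  assumes "h ` P \<subseteq> S"
  shows "bij_betw h P S \<longleftrightarrow> (\<forall>s\<in>S. \<exists>!u. u \<in> P \<and> h u = s)"
proof
  assume "bij_betw h P S"
  then show "\<forall>s\<in>S. \<exists>!u. u \<in> P \<and> h u = s"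
    unfolding bij_betw_def inj_on_def by blast
next
  assume ex1: "\<forall>s\<in>S. \<exists>!u. u \<in> P \<and> h u = s"
  have "inj_on h P"
  proof (rule inj_onI)
    fix u v assume uv: "u \<in> P" "v \<in> P" "h u = h v"
    then have "\<exists>!w. w \<in> P \<and> h w = h v" using assms ex1 by blast
    with uv show "u = v" by blast
  qed
  moreover have "S \<subseteq> h ` P" using ex1 by blast
  ultimately show "bij_betw h P S" using assms by (simp add: bij_betw_def subset_antisym)
qed

text \<open>Naturality already sends \<open>Ob F x\<close> into the set of compatible pairs, so the
  pullback condition reduces to bijectivity onto that set: each compatible pair has exactly one
  lift.\<close>

lemma cartesian_iff_ex1:
  assumes F: "is_functor C F" and G: "is_functor C G" and \<tau>: "is_nat_trans C F G \<tau>"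
  shows "cartesian C F G \<tau> \<longleftrightarrow>
    (\<forall>x y. \<forall>f\<in>Hom C x y. \<forall>a\<in>Ob F y. \<forall>b\<in>Ob G x. \<tau> y a = Map G x y f b \<longrightarrow>
      (\<exists>!u. u \<in> Ob F x \<and> Map F x y f u = a \<and> \<tau> x u = b))"
proof -
  have "is_pullback (Ob F x) (Ob F y) (Ob G x) (Ob G y) (Map F x y f) (\<tau> x) (\<tau> y) (Map G x y f) \<longleftrightarrow>
      (\<forall>a\<in>Ob F y. \<forall>b\<in>Ob G x. \<tau> y a = Map G x y f b \<longrightarrow>
        (\<exists>!u. u \<in> Ob F x \<and> Map F x y f u = a \<and> \<tau> x u = b))" (is "_ \<longleftrightarrow> ?R")
    if f: "f \<in> Hom C x y" for x y f
  proof -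
    let ?h = "\<lambda>u. (Map F x y f u, \<tau> x u)"
    let ?S = "{(a, b). a \<in> Ob F y \<and> b \<in> Ob G x \<and> \<tau> y a = Map G x y f b}"
    have "Map F x y f \<in> Ob F x \<rightarrow>\<^sub>E Ob F y" "Map G x y f \<in> Ob G x \<rightarrow>\<^sub>E Ob G y"
      "\<tau> x \<in> Ob F x \<rightarrow>\<^sub>E Ob G x" "\<tau> y \<in> Ob F y \<rightarrow>\<^sub>E Ob G y"
      using F G \<tau> f unfolding is_functor_def is_nat_trans_def by auto
    then have "is_pullback (Ob F x) (Ob F y) (Ob G x) (Ob G y) (Map F x y f) (\<tau> x) (\<tau> y) (Map G x y f)
        \<longleftrightarrow> bij_betw ?h (Ob F x) ?S"
      by (simp add: is_pullback_iff_bij)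
    also have "\<dots> \<longleftrightarrow> (\<forall>s\<in>?S. \<exists>!u. u \<in> Ob F x \<and> ?h u = s)"
    proof -
      have "?h ` Ob F x \<subseteq> ?S"
        using functor_mem[OF F f] nat_trans_mem[OF \<tau>] nat_trans_naturality[OF \<tau> f] by auto
      then show ?thesis by (rule bij_betw_iff_ex1)
    qed
    also have "\<dots> \<longleftrightarrow> ?R" by (simp add: Ball_def imp_conjL)
    finally show ?thesis .
  qed
  then show ?thesis unfolding cartesian_def by simp
qed

text \<open>Since \<open>tensor_rel\<close> is itself an equivalence relation, equality of classes
  is witnessed by a single permutation, with no chain of steps to follow.\<close>

lemma tensor_class_eqD:
  assumes A: "is_functor Surj_cat A" and x: "x \<in> injections n X" and a: "a \<in> Ob A n"
    and eq: "tensor_class A n X x a = tensor_class A n X y b"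
  obtains \<sigma> where "\<sigma> \<in> Sym n" "x = compose {1..n} y \<sigma>" "b = Map A n n \<sigma> a" "y \<in> injections n X"
proof -
  have "(x, a) \<in> tensor_class A n X y b"
    using tensor_class_self[OF A x a] eq by simp
  then have "((y, b), (x, a)) \<in> tensor_rel A n X"
    by (simp add: tensor_class_def)
  then have "((x, a), (y, b)) \<in> tensor_rel A n X"
    using equiv_tensor_rel[OF A] by (meson equivE symE)
  then show ?thesis using that unfolding tensor_rel_def by blast
qed

lemma tensor_class_inject:
  assumes A: "is_functor Surj_cat A" and x: "x \<in> injections n X" and a: "a \<in> Ob A n"
  shows "tensor_class A n X x a = tensor_class A n X x b \<longleftrightarrow> a = b"
proof
  assume "tensor_class A n X x a = tensor_class A n X x b"
  then obtain \<sigma> where \<sigma>: "\<sigma> \<in> Sym n" "x = compose {1..n} x \<sigma>" "b = Map A n n \<sigma> a"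
    using tensor_class_eqD[OF A x a] by metis
  \<comment> \<open>Cancel the injection \<open>x\<close> in x o \<sigma> = x = x o id.\<close>
  have "\<sigma> = Id Surj_cat n"
  proof (rule injections_cancel[OF x])
    show "\<sigma> \<in> {1..n} \<rightarrow>\<^sub>E {1..n}" using \<sigma>(1) by (simp add: Sym_def)
    show "Id Surj_cat n \<in> {1..n} \<rightarrow>\<^sub>E {1..n}" by (auto simp: Id_Surj)
    have "x = compose {1..n} x (Id Surj_cat n)"
      using x by (intro extensionalityI[of _ "{1..n}"])
        (auto simp: injections_def compose_def PiE_def Id_Surj)
    then show "compose {1..n} x \<sigma> = compose {1..n} x (Id Surj_cat n)" using \<sigma>(2) by simp
  qed
  then show "a = b" using \<sigma>(3) functor_id[OF A a] by simp
qed simp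

text \<open>Any representative (w, c) of \<open>z\<close> has w = x o \<sigma> for a permutation
  \<sigma>, by the equality of classes for \<open>B\<close>. Moving \<sigma> across the tensor gives
  the representative with \<open>x\<close> and A(\<sigma>)(c), and naturality at \<sigma> puts
  A(\<sigma>)(c) over \<open>b\<close>.\<close>

lemma hat_trans_eq_classE:
  assumes A: "is_functor Surj_cat A" and B: "is_functor Surj_cat B" and \<tau>: "is_nat_trans Surj_cat A B \<tau>"
    and z: "z \<in> hat_Ob A X" and eq: "hat_trans A B \<tau> X z = (n, tensor_class B n X x b)"
  obtains a where "a \<in> Ob A n" "z = (n, tensor_class A n X x a)" "\<tau> n a = b" "x \<in> injections n X"
proof -
  obtain k w c where z': "z = (k, tensor_class A k X w c)" and w: "w \<in> injections k X"
    and c: "c \<in> Ob A k"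
    using z by (rule hat_Ob_cases)
  have kn: "k = n" and cl: "tensor_class B n X w (\<tau> n c) = tensor_class B n X x b"
    using eq hat_trans_class[OF A B \<tau> w c] by (auto simp: z')
  obtain \<sigma> where \<sigma>: "\<sigma> \<in> Sym n" "w = compose {1..n} x \<sigma>" "b = Map B n n \<sigma> (\<tau> n c)"
      "x \<in> injections n X"
    using tensor_class_eqD[OF B _ _ cl] w c nat_trans_mem[OF \<tau>] unfolding kn by metis
  have cn: "c \<in> Ob A n" using c kn by simp
  show ?thesis
  proof (rule that)
    show "Map A n n \<sigma> c \<in> Ob A n" using functor_mem[OF A Sym_Hom[OF \<sigma>(1)] cn] .
    show "z = (n, tensor_class A n X x (Map A n n \<sigma> c))"
      using tensor_class_eqI[OF A tensor_relI[of x n X \<sigma> c A]] \<sigma> cn by (simp add: z' kn)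
    show "\<tau> n (Map A n n \<sigma> c) = b"
      using nat_trans_naturality[OF \<tau> Sym_Hom[OF \<sigma>(1)] cn] \<sigma>(3) by simp
  qed fact
qed

text \<open>The map u |-> [x, u] is a bijection from the lifts of (a, b) in the square at \<alpha>
  to the lifts of ([y, a], [x, b]) in the square at \<open>f\<close>.\<close>

lemma hat_pullback_iff:
  assumes A: "is_functor Surj_cat A" and B: "is_functor Surj_cat B" and \<tau>: "is_nat_trans Surj_cat A B \<tau>"
    and f: "f \<in> X \<rightarrow>\<^sub>E Y" and x: "x \<in> injections n X" and y: "y \<in> injections m Y"
    and \<alpha>: "\<alpha> \<in> Hom Surj_cat n m" and fx: "compose {1..n} f x = compose {1..n} y \<alpha>"
    and a: "a \<in> Ob A m" and b: "b \<in> Ob B n"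
  shows "(\<exists>!z. z \<in> hat_Ob A X \<and> hat_Map A X Y f z = (m, tensor_class A m Y y a) \<and>
      hat_trans A B \<tau> X z = (n, tensor_class B n X x b)) \<longleftrightarrow>
    (\<exists>!u. u \<in> Ob A n \<and> Map A n m \<alpha> u = a \<and> \<tau> n u = b)" (is "Ex1 ?P \<longleftrightarrow> Ex1 ?Q")
proof -
  let ?c = "\<lambda>u. (n, tensor_class A n X x u)"
  have P: "?P (?c u) \<longleftrightarrow> ?Q u" if u: "u \<in> Ob A n" for u
    using u tensor_class_hat_Ob[OF x u] hat_Map_class[OF A f x u \<alpha> y fx]
      hat_trans_class[OF A B \<tau> x u] tensor_class_inject[OF A y functor_mem[OF A \<alpha> u]]
      tensor_class_inject[OF B x nat_trans_mem[OF \<tau> u]]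
    by simp
  \<comment> \<open>Lying over [x, b] already gives \<open>z\<close> a representative with first
    component \<open>x\<close>.\<close>
  have surj: "\<exists>u\<in>Ob A n. z = ?c u" if "?P z" for z
    using that hat_trans_eq_classE[OF A B \<tau>] by metis
  have inj: "u = v" if "u \<in> Ob A n" "?c u = ?c v" for u v
    using that tensor_class_inject[OF A x] by simp
  show ?thesis
  proof
    assume "Ex1 ?P"
    then obtain z where z: "?P z" "\<And>z'. ?P z' \<Longrightarrow> z' = z" by blast
    then obtain u where u: "u \<in> Ob A n" "z = ?c u" using surj by blast
    show "Ex1 ?Q"
    proof (rule ex1I[of _ u])
      show "?Q u" using P[OF u(1)] z(1) u(2) by blast
      fix v assume v: "?Q v"
      then have "?P (?c v)" using P by blast
      then have "?c u = ?c v" using z(2) u(2) by metis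
      then show "v = u" using inj[OF u(1)] by metis
    qed
  next
    assume "Ex1 ?Q"
    then obtain u where u: "?Q u" "\<And>v. ?Q v \<Longrightarrow> v = u" by blast
    show "Ex1 ?P"
    proof (rule ex1I[of _ "?c u"])
      show "?P (?c u)" using P u(1) by blast
      fix z assume z: "?P z"
      then obtain v where "v \<in> Ob A n" "z = ?c v" using surj by blast
      then show "z = ?c u" using P z u(2) by blast
    qed
  qed
qed

text \<open>Transport \<alpha> along an embedding \<open>e\<close> of the naturals: \<open>f\<close>
  sends e(i) to e(\<alpha>(i)). The copies of {1..n} and {1..m} may overlap in \<open>'x\<close>,
  which is harmless because they serve as separate objects.\<close>

lemma surjection_realised:
  assumes inf: "infinite (UNIV :: 'x set)" and \<alpha>: "\<alpha> \<in> Hom Surj_cat n m"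
  obtains X Y :: "'x set" and f x y where "f \<in> X \<rightarrow>\<^sub>E Y" "x \<in> injections n X" "y \<in> injections m Y"
    "compose {1..n} f x = compose {1..n} y \<alpha>"
proof -
  obtain e :: "nat \<Rightarrow> 'x" where e: "inj e"
    using inf infinite_countable_subset by blast
  let ?x = "restrict e {1..n}" and ?y = "restrict e {1..m}"
  let ?f = "\<lambda>t\<in>e ` {1..n}. e (\<alpha> (inv e t))"
  have \<alpha>m: "\<alpha> i \<in> {1..m}" if "i \<in> {1..n}" for i
    using \<alpha> that unfolding Hom_Surj by (blast dest: PiE_mem)
  show ?thesis
  proof (rule that)
    show "?f \<in> e ` {1..n} \<rightarrow>\<^sub>E e ` {1..m}"
      using \<alpha>m e by (intro PiE_I) (auto simp del: atLeastAtMost_iff)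
    show "?x \<in> injections n (e ` {1..n})" "?y \<in> injections m (e ` {1..m})"
      using e by (auto simp: injections_def inj_on_def)
    show "compose {1..n} ?f ?x = compose {1..n} ?y \<alpha>"
      using \<alpha>m e by (auto simp: compose_def fun_eq_iff simp del: atLeastAtMost_iff)
  qed
qed

text \<open>The objects of \<open>Set_cat\<close> are subsets of one type \<open>'x\<close>; its
  infinity provides sets of every finite size, hence a test square for every surjection.\<close>

theorem proposition7p5:
  fixes A :: "(nat, nat \<Rightarrow> nat, 'a) set_functor"
    and B :: "(nat, nat \<Rightarrow> nat, 'b) set_functor"
    and \<tau> :: "nat \<Rightarrow> 'a \<Rightarrow> 'b"
  assumes "is_functor Surj_cat A" and "is_functor Surj_cat B"
    and "is_nat_trans Surj_cat A B \<tau>"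
    and "infinite (UNIV :: 'x set)"
  shows "cartesian Surj_cat A B \<tau> \<longleftrightarrow>
    cartesian (Set_cat :: ('x set, 'x \<Rightarrow> 'x) cat) (hat A) (hat B) (hat_trans A B \<tau>)"
  unfolding cartesian_iff_ex1[OF assms(1-3)] hat_simps
    cartesian_iff_ex1[OF hat_functor[OF assms(1)] hat_functor[OF assms(2)] hat_nat_trans[OF assms(1-3)]]
proof (intro iffI allI ballI impI)
  fix X Y :: "'x set" and f z w
  assume cart: "\<forall>n m. \<forall>\<alpha>\<in>Hom Surj_cat n m. \<forall>a\<in>Ob A m. \<forall>b\<in>Ob B n. \<tau> m a = Map B n m \<alpha> b \<longrightarrow>
      (\<exists>!u. u \<in> Ob A n \<and> Map A n m \<alpha> u = a \<and> \<tau> n u = b)"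
    and "f \<in> Hom Set_cat X Y" and z: "z \<in> hat_Ob A Y" and w: "w \<in> hat_Ob B X"
    and eq: "hat_trans A B \<tau> Y z = hat_Map B X Y f w"
  then have f: "f \<in> X \<rightarrow>\<^sub>E Y" by (simp add: Hom_Set)
  obtain n x b where w': "w = (n, tensor_class B n X x b)" and x: "x \<in> injections n X"
    and b: "b \<in> Ob B n"
    using w by (rule hat_Ob_cases)
  obtain m \<alpha> y where \<alpha>: "\<alpha> \<in> Hom Surj_cat n m" and y: "y \<in> injections m Y"
    and fx: "compose {1..n} f x = compose {1..n} y \<alpha>"
    using injections_map[OF f x] .
  \<comment> \<open>Compatibility says that \<open>z\<close> lies over [y, B(\<alpha>)(b)], so
    \<open>z\<close> can be written with this same \<open>y\<close>.\<close>
  obtain a where a: "a \<in> Ob A m" "\<tau> m a = Map B n m \<alpha> b" and z': "z = (m, tensor_class A m Y y a)"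
    using hat_trans_eq_classE[OF assms(1-3) z eq[unfolded w' hat_Map_class[OF assms(2) f x b \<alpha> y fx]]] .
  show "\<exists>!u. u \<in> hat_Ob A X \<and> hat_Map A X Y f u = z \<and> hat_trans A B \<tau> X u = w"
    unfolding w' z' hat_pullback_iff[OF assms(1-3) f x y \<alpha> fx a(1) b] using cart \<alpha> a b by blast
next
  fix n m \<alpha> a b
  assume cart: "\<forall>(X :: 'x set) Y. \<forall>f\<in>Hom Set_cat X Y. \<forall>z\<in>hat_Ob A Y. \<forall>w\<in>hat_Ob B X.
      hat_trans A B \<tau> Y z = hat_Map B X Y f w \<longrightarrow>
      (\<exists>!u. u \<in> hat_Ob A X \<and> hat_Map A X Y f u = z \<and> hat_trans A B \<tau> X u = w)"
    and \<alpha>: "\<alpha> \<in> Hom Surj_cat n m" and a: "a \<in> Ob A m" and b: "b \<in> Ob B n"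
    and eq: "\<tau> m a = Map B n m \<alpha> b"
  obtain X Y :: "'x set" and f x y where f: "f \<in> X \<rightarrow>\<^sub>E Y" and x: "x \<in> injections n X"
    and y: "y \<in> injections m Y" and fx: "compose {1..n} f x = compose {1..n} y \<alpha>"
    using surjection_realised[OF assms(4) \<alpha>] .
  \<comment> \<open>The compatible pair (a, b) yields a compatible pair of classes, whose unique
    lift transfers back to \<alpha>.\<close>
  have "hat_trans A B \<tau> Y (m, tensor_class A m Y y a) = hat_Map B X Y f (n, tensor_class B n X x b)"
    unfolding hat_trans_class[OF assms(1-3) y a] hat_Map_class[OF assms(2) f x b \<alpha> y fx] eq ..
  then show "\<exists>!u. u \<in> Ob A n \<and> Map A n m \<alpha> u = a \<and> \<tau> n u = b"
    unfolding hat_pullback_iff[OF assms(1-3) f x y \<alpha> fx a b, symmetric]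
    using cart f[folded Hom_Set] tensor_class_hat_Ob[OF y a] tensor_class_hat_Ob[OF x b] by blast
qed

end
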